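(* Let $n\ge 5$, let $A$ be a convex $n$-gon in $\mathbb{R}^2$ with vertices $(x_1,y_1),\ldots,(x_n,y_n)$ in cyclic order, let $T$ be the pentagram map, and let $(X,Y)=\lim_{k\to\infty}T^k(A)$. Then the vector $[X\ \ Y\ \ 1]^T\in\mathbb{R}^3$ is an eigenvector of the linear map $L_A:\mathbb{R}^3\to\mathbb{R}^3$.
   Context: A convex $n$-gon is a cyclically ordered tuple $A=(A_1,\ldots,A_n)$ of points of $\mathbb{R}^2$ that are, in this order, the vertices of a convex polygon, with no three vertices collinear; indices are taken modulo $n$. The pentagram map $T$ sends $A$ to the polygon $B=T(A)$ with vertices $B_i=\overleftrightarrow{A_{i-1}A_{i+1}}\cap\overleftrightarrow{A_iA_{i+2}}$, where $\overleftrightarrow{PQ}$ is the line through $P$ and $Q$. If $A$ is convex then $T(A)$ is convex and lies in the interior of $A$, so $T$ can be iterated. By a theorem of R. Schwartz, for convex $A$ the polygons $T^k(A)$, $k=0,1,2,\ldots$, converge to a single point of $\mathbb{R}^2$ (all vertices of $T^k(A)$ converge to this point); this point is denoted $\lim_{k\to\infty}T^k(A)$. Let $u_i=[x_i\ \ y_i\ \ 1]^T\in\mathbb{R}^3$. The linear map $L_A:\mathbb{R}^3\to\mathbb{R}^3$ is defined by $$L_A(v)=nv-\sum_{j=1}^n\frac{|u_{j-1},v,u_{j+1}|}{|u_{j-1},u_j,u_{j+1}|}\,u_j,$$ where $|\cdot,\cdot,\cdot|$ denotes the determinant of three vectors in $\mathbb{R}^3$ and indices are modulo $n$. *)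

theory Defs
  imports "HOL-Analysis.Analysis"
begin

(* Indices modulo n: an n-tuple (A_1, ..., A_n) is represented by its n-periodic extension to
   the integers.  The clause on edges says that the vertices occur in the given cyclic order
   along the boundary of the polygon. *)
definition convex_ngon :: "nat \<Rightarrow> (int \<Rightarrow> real^2) \<Rightarrow> bool" where
  "convex_ngon n A \<longleftrightarrow>
     3 \<le> n \<and>
     (\<forall>i. A (i + int n) = A i) \<and>
     (\<forall>i. A i extreme_point_of convex hull (range A)) \<and>
     (\<forall>i. closed_segment (A i) (A (i + 1)) edge_of convex hull (range A)) \<and>
     (\<forall>i\<in>{1..int n}. \<forall>j\<in>{1..int n}. \<forall>k\<in>{1..int n}.
        i \<noteq> j \<longrightarrow> i \<noteq> k \<longrightarrow> j \<noteq> k \<longrightarrow> \<not> collinear {A i, A j, A k})"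

definition pentagram :: "(int \<Rightarrow> real^2) \<Rightarrow> int \<Rightarrow> real^2" where
  "pentagram A i =
     (THE p. p \<in> affine hull {A (i - 1), A (i + 1)} \<inter> affine hull {A i, A (i + 2)})"

definition homog :: "real^2 \<Rightarrow> real^3" where
  "homog p = vector [p $ 1, p $ 2, 1]"

definition det3 :: "real^3 \<Rightarrow> real^3 \<Rightarrow> real^3 \<Rightarrow> real" where
  "det3 a b c = det (vector [a, b, c] :: real^3^3)"

definition L_map :: "nat \<Rightarrow> (int \<Rightarrow> real^2) \<Rightarrow> real^3 \<Rightarrow> real^3" where
  "L_map n A v =
     real n *\<^sub>R v -
     (\<Sum>j\<in>{1..int n}.
        (det3 (homog (A (j - 1))) v (homog (A (j + 1))) /
         det3 (homog (A (j - 1))) (homog (A j)) (homog (A (j + 1)))) *\<^sub>R homog (A j))"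

lemma linear_det3_middle: "linear (\<lambda>v. det3 a v c)"
  by (rule linearI) (simp_all add: det3_def det_3 vector_3 algebra_simps)

lemma linear_L_map: "linear (L_map n A)"
  by (rule linearI)
     (simp_all add: L_map_def linear_add[OF linear_det3_middle] linear_cmul[OF linear_det3_middle]
        add_divide_distrib scaleR_add_left sum.distrib scaleR_add_right scaleR_diff_right
        scaleR_sum_right mult.commute)

definition eigenvector_of :: "('a::real_vector) \<Rightarrow> ('a \<Rightarrow> 'a) \<Rightarrow> bool" (infix \<open>eigenvector'_of\<close> 50) where
  "v eigenvector_of f \<longleftrightarrow> v \<noteq> 0 \<and> (\<exists>c::real. f v = c *\<^sub>R v)"

end

theory Submission
  imports Defs
begin

text \<open>
  \<^term>\<open>L_map n A\<close> is invariant under the pentagram map, and if \<^term>\<open>A\<close> is convex it sends (the lift of) a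
  vertex of \<^term>\<open>A\<close> into the convex cone spanned by the lifted vertices: in
  \<^term>\<open>L_map n A (homog (A i))\<close> the vertex \<^term>\<open>A i\<close> occurs with coefficient \<open>n - 1\<close>, its neighbours
  with coefficient \<open>0\<close>, and any other vertex \<^term>\<open>A j\<close> with a positive coefficient because the diagonal
  from \<^term>\<open>A (j - 1)\<close> to \<^term>\<open>A (j + 1)\<close> separates it from \<^term>\<open>A i\<close>. Applied to the iterates of \<^term>\<open>A\<close>, this shows that the same linear map sends a lifted
  vertex of each iterate into the cone over that iterate. These cones shrink to the ray through
  the limit point, so by continuity this ray is mapped into itself.
\<close>

section \<open>Signed areas and linear relations between lifted points\<close>

text \<open>Twice the signed area of the triangle \<open>p q r\<close>. For fixed \<open>p\<close>
  and \<open>q\<close> it is a linear functional of \<open>homog r\<close> that vanishes on the line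
  through \<open>p\<close> and \<open>q\<close>.\<close>

definition turn :: "real^2 \<Rightarrow> real^2 \<Rightarrow> real^2 \<Rightarrow> real" where
  "turn p q r = det3 (homog p) (homog q) (homog r)"

lemma det3_expand:
  "det3 a b c = a$1 * (b$2 * c$3 - b$3 * c$2) - a$2 * (b$1 * c$3 - b$3 * c$1)
     + a$3 * (b$1 * c$2 - b$2 * c$1)"
  by (simp add: det3_def det_3 vector_3 algebra_simps)

lemma homog_nth [simp]: "homog p $ 1 = p $ 1" "homog p $ 2 = p $ 2" "homog p $ 3 = 1"
  by (simp_all add: homog_def vector_3)

lemma homog_combination: "homog ((1 - t) *\<^sub>R p + t *\<^sub>R q) = (1 - t) *\<^sub>R homog p + t *\<^sub>R homog q"
  by (simp add: vec_eq_iff forall_3)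

lemma turn_expand:
  "turn p q r = (q$1 - p$1) * (r$2 - p$2) - (q$2 - p$2) * (r$1 - p$1)"
  by (simp add: turn_def det3_expand algebra_simps)

lemma turn_cycle: "turn q r p = turn p q r"
  by (simp add: turn_expand algebra_simps)

lemma turn_swap: "turn p r q = - turn p q r"
  by (simp add: turn_expand algebra_simps)

lemma turn_degenerate [simp]: "turn p p q = 0" "turn p q q = 0" "turn p q p = 0"
  by (simp_all add: turn_expand algebra_simps)

lemma turn_combination:
  "turn p q ((1 - t) *\<^sub>R a + t *\<^sub>R b) = (1 - t) * turn p q a + t * turn p q b"
  by (simp add: turn_expand algebra_simps)

lemma turn_combination_of_endpoints:
  "turn ((1 - s) *\<^sub>R p + s *\<^sub>R q) ((1 - t) *\<^sub>R p + t *\<^sub>R q) r = (t - s) * turn p q r"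
  by (simp add: turn_expand algebra_simps)

text \<open>Cramer's rule for four vectors of R^3. The terms are arranged so that for a convex
  quadrilateral \<open>p q r s\<close> all four coefficients have the same sign, and both sides are
  multiples of the lifted intersection point of the diagonals.\<close>

lemma turn_relation:
  "turn q r s *\<^sub>R homog p + turn p q s *\<^sub>R homog r = turn p r s *\<^sub>R homog q + turn p q r *\<^sub>R homog s"
  by (simp add: vec_eq_iff forall_3 turn_expand algebra_simps)

text \<open>Image of \<open>turn_relation\<close> under the linear functional belonging to
  \<open>turn x y\<close>.\<close>

lemma turn_affine_relation:
  "turn q r s * turn x y p + turn p q s * turn x y r = turn p r s * turn x y q + turn p q r * turn x y s"
  by (simp add: turn_expand algebra_simps)

section \<open>Convex polygons described by orientation signs\<close>

text \<open>The factor \<open>\<sigma>\<close> carries the orientation, so that both orientations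
  are treated at once; only its sign matters. The range of \<open>k\<close> runs once through the
  vertices other than the two ends of the edge.\<close>

definition oriented_convex :: "nat \<Rightarrow> real \<Rightarrow> (int \<Rightarrow> real^2) \<Rightarrow> bool" where
  "oriented_convex n \<sigma> A \<longleftrightarrow>
     (\<forall>i. A (i + int n) = A i) \<and>
     (\<forall>i k. i + 1 < k \<longrightarrow> k < i + int n \<longrightarrow> 0 < \<sigma> * turn (A i) (A (i + 1)) (A k))"

lemma oriented_convex_periodic: "oriented_convex n \<sigma> A \<Longrightarrow> A (i + int n) = A i"
  by (simp add: oriented_convex_def)

lemma oriented_convex_edge:
  "oriented_convex n \<sigma> A \<Longrightarrow> j = i + 1 \<Longrightarrow> j < k \<Longrightarrow> k < i + int n \<Longrightarrow> 0 < \<sigma> * turn (A i) (A j) (A k)"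
  by (simp add: oriented_convex_def)

lemma oriented_convex_diagonal:
  assumes A: "oriented_convex n \<sigma> A" and m: "m = i + 2" and k: "m < k" "k < i + int n"
  shows "0 < \<sigma> * turn (A i) (A m) (A k)"
proof (rule ccontr)
  \<comment> \<open>Otherwise \<open>x\<close> lies in the triangle \<open>pqr\<close>, and the edge line through \<open>x\<close> cannot have all of
      \<open>p, q, r\<close> on its nonnegative side.\<close>
  assume neg: "\<not> ?thesis"
  define p q r x y where "p = A i" and "q = A (i + 1)" and "r = A m" and "x = A k" and "y = A (k + 1)"
  have pqx: "0 < \<sigma> * turn p q x" and qrx: "0 < \<sigma> * turn q r x"
    using oriented_convex_edge[OF A, of "i + 1" i] oriented_convex_edge[OF A, of m "i + 1"] k m
    by (simp_all add: p_def q_def r_def x_def)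
  have shift: "A (j + int n) = A j" for j
    using oriented_convex_periodic[OF A] .
  have q: "0 < \<sigma> * turn x y q" and r: "0 < \<sigma> * turn x y r"
    using oriented_convex_edge[OF A, of "k + 1" k "i + 1 + int n"]
      oriented_convex_edge[OF A, of "k + 1" k "m + int n"] k m
    unfolding shift q_def r_def x_def y_def by auto
  \<comment> \<open>Only a weak inequality: the edge that starts at \<open>x\<close> may end at
    \<open>p\<close>.\<close>
  have p: "0 \<le> \<sigma> * turn x y p"
  proof (cases "k + 1 = i + int n")
    case True
    then show ?thesis by (simp add: y_def p_def shift)
  next
    case False
    then show ?thesis
      using oriented_convex_edge[OF A, of "k + 1" k "i + int n"] k m
      unfolding shift p_def x_def y_def by auto
  qed
  \<comment> \<open>The fourth term of the relation vanishes because
    \<open>turn x y x = 0\<close>.\<close>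
  have "(\<sigma> * turn q r x) * (\<sigma> * turn x y p) + (\<sigma> * turn p q x) * (\<sigma> * turn x y r)
      = (\<sigma> * turn p r x) * (\<sigma> * turn x y q)"
    using turn_affine_relation[of q r x x y p] by (simp add: algebra_simps flip: distrib_left)
  moreover have "0 < (\<sigma> * turn p q x) * (\<sigma> * turn x y r)"
    using pqx r by (rule mult_pos_pos)
  moreover have "0 \<le> (\<sigma> * turn q r x) * (\<sigma> * turn x y p)"
    using qrx p by simp
  moreover have "(\<sigma> * turn p r x) * (\<sigma> * turn x y q) \<le> 0"
    using mult_nonpos_nonneg[OF _ less_imp_le[OF q]] neg by (simp add: p_def r_def x_def not_less)
  ultimately show False by linarith
qed

section \<open>Position of the pentagram vertices and preservation of convexity\<close>

text \<open>Along the line through \<open>A (i - 1)\<close> and \<open>A (i + 1)\<close>, the value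
  of \<open>turn (A i) (A (i + 2))\<close> is an affine function of the parameter. By
  \<open>indep\<close> it is not constant, so the two lines share at most one point.\<close>

lemma pentagram_eqI:
  assumes p: "p = (1 - s) *\<^sub>R A (i - 1) + s *\<^sub>R A (i + 1)" "p = (1 - t) *\<^sub>R A i + t *\<^sub>R A (i + 2)"
    and indep: "turn (A i) (A (i + 2)) (A (i - 1)) \<noteq> turn (A i) (A (i + 2)) (A (i + 1))"
  shows "pentagram A i = p"
  unfolding pentagram_def
proof (rule the_equality)
  have hull: "z \<in> affine hull {a, b} \<longleftrightarrow> (\<exists>s. z = (1 - s) *\<^sub>R a + s *\<^sub>R b)" for z a b :: "real^2"
  proof -
    have "u = 1 - v" if "u + v = 1" for u v :: real
      using that by simp
    moreover have "1 - v + v = 1" for v :: real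
      by simp
    ultimately show ?thesis
      unfolding affine_hull_2 mem_Collect_eq by blast
  qed
  show "p \<in> affine hull {A (i - 1), A (i + 1)} \<inter> affine hull {A i, A (i + 2)}"
    using p hull by blast
  fix z assume "z \<in> affine hull {A (i - 1), A (i + 1)} \<inter> affine hull {A i, A (i + 2)}"
  then obtain s' t' where z: "z = (1 - s') *\<^sub>R A (i - 1) + s' *\<^sub>R A (i + 1)"
      "z = (1 - t') *\<^sub>R A i + t' *\<^sub>R A (i + 2)"
    using hull by blast
  let ?f = "turn (A i) (A (i + 2))"
  have "?f z = 0" "?f p = 0"
    by (simp_all add: z(2) p(2) turn_combination del: scaleR_left_diff_distrib)
  then have "(1 - s') * ?f (A (i - 1)) + s' * ?f (A (i + 1)) = 0"
      "(1 - s) * ?f (A (i - 1)) + s * ?f (A (i + 1)) = 0"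
    by (simp_all add: z(1) p(1) turn_combination)
  then have "(s' - s) * (?f (A (i + 1)) - ?f (A (i - 1))) = 0"
    by (simp add: algebra_simps)
  with indep show "z = p"
    by (simp add: z(1) p(1))
qed

text \<open>The vertices \<open>A (i - 1)\<close>, ..., \<open>A (i + 2)\<close> form a convex
  quadrilateral, so \<open>turn_relation\<close> has coefficients of one sign. Dividing by the
  common total \<open>a + b = c + d\<close> writes one point as a convex combination on each
  diagonal.\<close>

lemma pentagram_between:
  assumes n: "5 \<le> n" and A: "oriented_convex n \<sigma> A"
  obtains s t where "0 < s" "s < 1" "0 < t" "t < 1"
    "pentagram A i = (1 - s) *\<^sub>R A (i - 1) + s *\<^sub>R A (i + 1)"
    "pentagram A i = (1 - t) *\<^sub>R A i + t *\<^sub>R A (i + 2)"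
proof -
  define p q r x where "p = A (i - 1)" and "q = A i" and "r = A (i + 1)" and "x = A (i + 2)"
  define a b c d where "a = \<sigma> * turn q r x" and "b = \<sigma> * turn p q x"
    and "c = \<sigma> * turn p r x" and "d = \<sigma> * turn p q r"
  have pos: "0 < a" "0 < b" "0 < c" "0 < d"
    using oriented_convex_edge[OF A, of "i + 1" i "i + 2"] oriented_convex_edge[OF A, of "i" "i - 1" "i + 2"]
      oriented_convex_edge[OF A, of "i + 2" "i + 1" "i - 1 + int n"]
      oriented_convex_edge[OF A, of "i" "i - 1" "i + 1"] n
    unfolding oriented_convex_periodic[OF A] a_def b_def c_def d_def p_def q_def r_def x_def
    by (simp_all add: turn_cycle)
  have sum: "a + b = c + d"
    by (simp add: a_def b_def c_def d_def turn_expand algebra_simps)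
  have "a *\<^sub>R homog p + b *\<^sub>R homog r = c *\<^sub>R homog q + d *\<^sub>R homog x"
    using arg_cong[OF turn_relation[of q r x p], of "\<lambda>v. \<sigma> *\<^sub>R v"]
    by (simp add: a_def b_def c_def d_def scaleR_add_right)
  then have "a *\<^sub>R p + b *\<^sub>R r = c *\<^sub>R q + d *\<^sub>R x"
    by (simp add: vec_eq_iff forall_3 forall_2)
  then have "(1 / (a + b)) *\<^sub>R (a *\<^sub>R p + b *\<^sub>R r) = (1 / (a + b)) *\<^sub>R (c *\<^sub>R q + d *\<^sub>R x)"
    by simp
  moreover have "a / (a + b) = 1 - b / (a + b)" "c / (a + b) = 1 - d / (a + b)"
    using pos sum by (simp_all add: field_simps)
  ultimately have eq: "(1 - b / (a + b)) *\<^sub>R p + (b / (a + b)) *\<^sub>R r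
      = (1 - d / (a + b)) *\<^sub>R q + (d / (a + b)) *\<^sub>R x"
    by (simp add: scaleR_add_right)
  have "turn q x r \<noteq> turn q x p"
  proof
    assume "turn q x r = turn q x p"
    moreover have "turn q x r = - turn q r x" "turn q x p = turn p q x"
      by (simp_all add: turn_expand algebra_simps)
    ultimately have "\<sigma> * (- turn q r x) = \<sigma> * turn p q x"
      by metis
    then have "- a = b"
      by (simp add: a_def b_def)
    with pos show False by simp
  qed
  then have "pentagram A i = (1 - b / (a + b)) *\<^sub>R p + (b / (a + b)) *\<^sub>R r"
    using eq unfolding p_def q_def r_def x_def
    by (intro pentagram_eqI[where s = "b / (a + b)" and t = "d / (a + b)"]) auto
  then show thesis
    using that[of "b / (a + b)" "d / (a + b)"] eq pos sum
    unfolding p_def q_def r_def x_def by (auto simp: field_simps)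
qed


text \<open>The point lies strictly between \<open>A j\<close>, which is on the diagonal, and
  \<open>A (j + 2)\<close>, which is strictly beyond it.\<close>

lemma pentagram_beyond_diagonal:
  assumes n: "5 \<le> n" and A: "oriented_convex n \<sigma> A" and ij: "i = j - 2" "m = j"
  shows "0 < \<sigma> * turn (A i) (A m) (pentagram A j)"
proof -
  obtain t where t: "0 < t" "t < 1" "pentagram A j = (1 - t) *\<^sub>R A j + t *\<^sub>R A (j + 2)"
    using pentagram_between[OF n A, of j] by metis
  \<comment> \<open>Here \<open>n \<ge> 5\<close> enters: it gives \<open>j + 2 < i + int n\<close>,
    whereas for \<open>n = 4\<close> the vertex would coincide with \<open>A i\<close>.\<close>
  have "0 < \<sigma> * turn (A i) (A m) (A (j + 2))"
    using oriented_convex_diagonal[OF A, of m i "j + 2"] n ij by simp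
  then have "0 < t * (\<sigma> * turn (A i) (A m) (A (j + 2)))"
    using t by simp
  then show ?thesis
    using ij unfolding t(3) turn_combination by (simp add: mult.left_commute)
qed

text \<open>The line through \<open>A (i - 1)\<close> and \<open>A (i + 1)\<close> crosses the
  diagonal from \<open>A i\<close> to \<open>A (i + 2)\<close> at \<open>pentagram A i\<close>, and
  \<open>pentagram A (i + 1)\<close> lies on its far side. The function \<open>?f\<close> measuring
  the side increases along the diagonal, hence \<open>s < t\<close>.\<close>

lemma pentagram_order_on_diagonal:
  assumes n: "5 \<le> n" and A: "oriented_convex n \<sigma> A"
  obtains s t where "0 < s" "s < t"
    "pentagram A i = (1 - s) *\<^sub>R A i + s *\<^sub>R A (i + 2)"
    "pentagram A (i + 1) = (1 - t) *\<^sub>R A i + t *\<^sub>R A (i + 2)"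
proof -
  obtain r s where s: "0 < s" "s < 1" "pentagram A i = (1 - s) *\<^sub>R A i + s *\<^sub>R A (i + 2)"
    and r: "pentagram A i = (1 - r) *\<^sub>R A (i - 1) + r *\<^sub>R A (i + 1)"
    using pentagram_between[OF n A, of i] by metis
  obtain t where t: "0 < t" "t < 1" "pentagram A (i + 1) = (1 - t) *\<^sub>R A i + t *\<^sub>R A (i + 2)"
  proof -
    have "i + 1 - 1 = i" "i + 1 + 1 = i + 2"
      by simp_all
    then show ?thesis
      using pentagram_between[OF n A, of "i + 1"] that by metis
  qed
  let ?f = "\<lambda>x. \<sigma> * turn (A (i - 1)) (A (i + 1)) x"
  have "?f (A i) = - (\<sigma> * turn (A (i - 1)) (A i) (A (i + 1)))"
    by (simp add: turn_expand algebra_simps)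
  then have neg: "?f (A i) < 0"
    using oriented_convex_edge[OF A, of i "i - 1" "i + 1"] n by simp
  have pos: "0 < ?f (A (i + 2))"
    using oriented_convex_diagonal[OF A, of "i + 1" "i - 1" "i + 2"] n by simp
  have lin: "?f ((1 - u) *\<^sub>R A i + u *\<^sub>R A (i + 2)) = ?f (A i) + u * (?f (A (i + 2)) - ?f (A i))" for u
    unfolding turn_combination by (simp add: algebra_simps)
  have "?f (pentagram A i) = 0"
    by (simp add: r turn_combination)
  moreover have "0 < ?f (pentagram A (i + 1))"
    using pentagram_beyond_diagonal[OF n A, of "i - 1" "i + 1" "i + 1"] by simp
  ultimately have "s * (?f (A (i + 2)) - ?f (A i)) < t * (?f (A (i + 2)) - ?f (A i))"
    unfolding s(3) t(3) lin by linarith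
  then have "s < t"
    using neg pos by (simp add: mult_less_cancel_right)
  with s t show thesis
    using that by blast
qed

text \<open>The new edge runs along the diagonal from \<open>A i\<close> to
  \<open>A (i + 2)\<close>, in the same direction because \<open>s < t\<close>. It remains to see
  that each further new vertex is on the positive side of this diagonal.\<close>

lemma oriented_convex_pentagram:
  assumes n: "5 \<le> n" and A: "oriented_convex n \<sigma> A"
  shows "oriented_convex n \<sigma> (pentagram A)"
  unfolding oriented_convex_def
proof (intro conjI allI impI)
  fix i
  have "A (i + int n - 1) = A (i - 1)" "A (i + int n + 1) = A (i + 1)" "A (i + int n + 2) = A (i + 2)"
    using oriented_convex_periodic[OF A, of "i - 1"] oriented_convex_periodic[OF A, of "i + 1"]
      oriented_convex_periodic[OF A, of "i + 2"] by (simp_all add: algebra_simps)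
  then show "pentagram A (i + int n) = pentagram A i"
    by (simp add: pentagram_def oriented_convex_periodic[OF A])
next
  fix i k assume k: "i + 1 < k" "k < i + int n"
  obtain s t where st: "s < t"
    "pentagram A i = (1 - s) *\<^sub>R A i + s *\<^sub>R A (i + 2)"
    "pentagram A (i + 1) = (1 - t) *\<^sub>R A i + t *\<^sub>R A (i + 2)"
    using pentagram_order_on_diagonal[OF n A, of i] by metis
  let ?f = "\<lambda>x. \<sigma> * turn (A i) (A (i + 2)) x"
  have pos: "0 < ?f (A m)" if "i + 2 < m" "m < i + int n" for m
    using oriented_convex_diagonal[OF A] that by simp
  have lin: "?f ((1 - u) *\<^sub>R x + u *\<^sub>R y) = (1 - u) * ?f x + u * ?f y" for u x y
    unfolding turn_combination by (simp add: algebra_simps)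
  have "0 < ?f (pentagram A k)"
  \<comment> \<open>For \<open>k = i + 2\<close> the neighbour \<open>A (k - 1)\<close> is on the
    negative side, so the averaging argument of the other case does not apply.\<close>
  proof (cases "k = i + 2")
    case True
    then show ?thesis
      using pentagram_beyond_diagonal[OF n A, of i k k] by simp
  next
    case False
    obtain u where u: "0 < u" "u < 1" "pentagram A k = (1 - u) *\<^sub>R A (k - 1) + u *\<^sub>R A (k + 1)"
      using pentagram_between[OF n A, of k] by metis
    have first: "0 \<le> ?f (A (k - 1))"
    proof (cases "k - 1 = i + 2")
      case True
      show ?thesis
        unfolding True by simp
    next
      case False
      then show ?thesis
        using pos[of "k - 1"] k \<open>k \<noteq> i + 2\<close> by simp
    qed
    have last: "0 \<le> ?f (A (k + 1))"
    proof (cases "k + 1 = i + int n")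
      case True
      show ?thesis
        unfolding True oriented_convex_periodic[OF A] by simp
    next
      case False
      then show ?thesis
        using pos[of "k + 1"] k by simp
    qed
    \<comment> \<open>Both neighbours lie on the diagonal only if \<open>k - 1 = i + 2\<close> and
      \<open>k + 1 = i + int n\<close>, which forces \<open>n = 4\<close>.\<close>
    have "0 < ?f (A (k - 1)) \<or> 0 < ?f (A (k + 1))"
      using pos[of "k - 1"] pos[of "k + 1"] k False n by linarith
    then have "0 < (1 - u) * ?f (A (k - 1)) + u * ?f (A (k + 1))"
    proof
      assume "0 < ?f (A (k - 1))"
      then show ?thesis
        using u add_pos_nonneg[OF mult_pos_pos mult_nonneg_nonneg[OF _ last]] by simp
    next
      assume "0 < ?f (A (k + 1))"
      then show ?thesis
        using u add_nonneg_pos[OF mult_nonneg_nonneg[OF _ first] mult_pos_pos] by simp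
    qed
    then show ?thesis
      unfolding u(3) lin .
  qed
  then have "0 < (t - s) * ?f (pentagram A k)"
    using st(1) by simp
  then show "0 < \<sigma> * turn (pentagram A i) (pentagram A (i + 1)) (pentagram A k)"
    unfolding st turn_combination_of_endpoints by (simp add: algebra_simps)
qed

section \<open>Invariance of the operator under the pentagram map\<close>

text \<open>
  Write \<open>a, b, c, d\<close> for the lifts of four consecutive vertices \<open>A\<^sub>j\<^sub>-\<^sub>2, \<dots>, A\<^sub>j\<^sub>+\<^sub>1\<close> and \<open>w, w', w''\<close> for those of
  \<open>B\<^sub>j\<^sub>-\<^sub>1, B\<^sub>j, B\<^sub>j\<^sub>+\<^sub>1\<close>. Then \<open>P\<close> and \<open>Q\<close> are the \<open>j\<close>-th summands of the operators of \<open>A\<close> and \<open>B\<close>, with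
  input \<open>v\<close>, and their difference is \<open>K' - K\<close>, where \<open>K'\<close> is \<open>K\<close> shifted by one index; hence the
  difference of the sums telescopes.
\<close>
lemma pentagram_projections:
  fixes a b c d e v w w' w'' :: "real^3"
  defines "P \<equiv> (det3 b v d / det3 b c d) *\<^sub>R c"
    and "Q \<equiv> (det3 w v w'' / det3 w w' w'') *\<^sub>R w'"
    and "K \<equiv> (det3 a v c / det3 a w' c) *\<^sub>R w'"
    and "K' \<equiv> (det3 b v d / det3 b w'' d) *\<^sub>R w''"
  assumes w: "w = (1 - s) *\<^sub>R a + s *\<^sub>R c" "w = (1 - t) *\<^sub>R b + t *\<^sub>R d" and st: "s \<noteq> 1" "t \<noteq> 1"
    and w': "w' = (1 - x) *\<^sub>R b + x *\<^sub>R d"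
    and c: "p *\<^sub>R c = y *\<^sub>R w' + z *\<^sub>R w''" "p \<noteq> 0" "z \<noteq> 0"
    and ne: "det3 a w' c \<noteq> 0" "det3 b w'' d \<noteq> 0"
  shows "Q + K' = P + K"
proof -
  let ?\<alpha> = "\<lambda>v. det3 a v c" and ?\<beta> = "\<lambda>v. det3 b v d" and ?\<mu> = "\<lambda>v. det3 w v w''"
  have beta_w': "?\<beta> w' = 0"
    by (simp add: w' det3_expand algebra_simps)
  have \<alpha>: "det3 w v c = (1 - s) * ?\<alpha> v" for v
    by (simp add: w(1) det3_expand algebra_simps)
  have \<beta>: "det3 w v d = (1 - t) * ?\<beta> v" for v
    by (simp add: w(2) det3_expand algebra_simps)
  \<comment> \<open>Three-term Pluecker relation for the alternating form that \<open>det3 w\<close>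
    induces on the quotient of R^3 by \<open>w\<close>.\<close>
  have pluecker: "det3 w v c * det3 w w'' d - det3 w v d * det3 w w'' c = det3 w v w'' * det3 w c d" for v
    unfolding det3_expand by algebra
  let ?r = "(1 - s) * (1 - t)" and ?R = "det3 w c d"
  have mu: "?\<mu> v * ?R = ?r * (?\<alpha> v * ?\<beta> w'' - ?\<beta> v * ?\<alpha> w'')" for v
    using pluecker[of v] by (simp add: \<alpha> \<beta> algebra_simps)
  have r: "?r \<noteq> 0"
    using st by simp
  \<comment> \<open>For the input \<open>w'\<close> the \<open>?\<beta>\<close> term drops out, so
    \<open>ne\<close> yields that both \<open>?R\<close> and the denominator of \<open>Q\<close> are
    nonzero.\<close>
  have ne': "?\<mu> w' * ?R \<noteq> 0"
    unfolding mu beta_w' using r ne by simp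
  have "?\<mu> v / ?\<mu> w' = (?\<mu> v * ?R) / (?\<mu> w' * ?R)"
    using ne' by simp
  also have "\<dots> = (?\<alpha> v * ?\<beta> w'' - ?\<beta> v * ?\<alpha> w'') / (?\<alpha> w' * ?\<beta> w'')"
    unfolding mu beta_w' using mult_divide_mult_cancel_left[OF r] by simp
  finally have Q: "Q = (?\<alpha> v / ?\<alpha> w' - ?\<beta> v * ?\<alpha> w'' / (?\<alpha> w' * ?\<beta> w'')) *\<^sub>R w'"
    using ne by (simp add: Q_def diff_divide_distrib)
  \<comment> \<open>Evaluating both functionals on the relation for \<open>c\<close> gives the
    denominator of \<open>P\<close> and the ratio of \<open>?\<alpha> w''\<close> to
    \<open>?\<alpha> w'\<close>.\<close>
  have "p * ?\<beta> c = ?\<beta> (p *\<^sub>R c)" "p * ?\<alpha> c = ?\<alpha> (p *\<^sub>R c)"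
    by (simp_all add: det3_expand algebra_simps)
  moreover have "?\<beta> (y *\<^sub>R w' + z *\<^sub>R w'') = y * ?\<beta> w' + z * ?\<beta> w''"
      "?\<alpha> (y *\<^sub>R w' + z *\<^sub>R w'') = y * ?\<alpha> w' + z * ?\<alpha> w''" "?\<alpha> c = 0"
    by (simp_all add: det3_expand algebra_simps)
  ultimately have c': "p * ?\<beta> c = z * ?\<beta> w''" "y * ?\<alpha> w' + z * ?\<alpha> w'' = 0"
    using c beta_w' by simp_all
  have "P = (?\<beta> v / (p * ?\<beta> c)) *\<^sub>R (p *\<^sub>R c)"
    using c(2) by (simp add: P_def)
  then have P: "P = (?\<beta> v * y / (z * ?\<beta> w'')) *\<^sub>R w' + (?\<beta> v / ?\<beta> w'') *\<^sub>R w''"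
    unfolding c' c(1) using c(3) by (simp add: scaleR_add_right)
  have "?\<alpha> w'' = - (y * ?\<alpha> w' / z)"
    using c' c(3) by (simp add: field_simps)
  then have "- (?\<beta> v * ?\<alpha> w'' / (?\<alpha> w' * ?\<beta> w'')) = ?\<beta> v * y / (z * ?\<beta> w'')"
    using ne c(3) by simp
  then have Q': "Q = (?\<alpha> v / ?\<alpha> w') *\<^sub>R w' + (?\<beta> v * y / (z * ?\<beta> w'')) *\<^sub>R w'"
    unfolding Q scaleR_add_left[symmetric] by simp
  show ?thesis
    unfolding P Q' K_def K'_def by simp
qed

lemma L_map_pentagram:
  assumes n: "5 \<le> n" and A: "oriented_convex n \<sigma> A"
  shows "L_map n (pentagram A) = L_map n A"
proof
  fix v
  let ?B = "pentagram A"
  \<comment> \<open>As maps of \<open>v\<close> these are projections: \<open>P C j\<close> onto the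
    lift of \<open>C j\<close> along the plane over \<open>C (j - 1)\<close> and
    \<open>C (j + 1)\<close>, and \<open>K j\<close> onto the lift of \<open>?B j\<close> along the
    plane over \<open>A (j - 2)\<close> and \<open>A j\<close>.\<close>
  define P where "P C j = (det3 (homog (C (j - 1))) v (homog (C (j + 1))) /
      det3 (homog (C (j - 1))) (homog (C j)) (homog (C (j + 1)))) *\<^sub>R homog (C j)" for C and j :: int
  define K where "K j = (det3 (homog (A (j - 2))) v (homog (A j)) /
      det3 (homog (A (j - 2))) (homog (?B j)) (homog (A j))) *\<^sub>R homog (?B j)" for j
  have step: "P ?B j + K (j + 1) = P A j + K j" for j
  proof -
    obtain s t where st: "s < 1" "t < 1"
      "?B (j - 1) = (1 - s) *\<^sub>R A (j - 2) + s *\<^sub>R A j"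
      "?B (j - 1) = (1 - t) *\<^sub>R A (j - 1) + t *\<^sub>R A (j + 1)"
    proof -
      have "j - 1 - 1 = j - 2" "j - 1 + 1 = j" "j - 1 + 2 = j + 1"
        by simp_all
      then show ?thesis
        using pentagram_between[OF n A, of "j - 1"] that by metis
    qed
    obtain x where x: "?B j = (1 - x) *\<^sub>R A (j - 1) + x *\<^sub>R A (j + 1)"
      using pentagram_between[OF n A, of j] by metis
    obtain y z where yz: "0 < y" "y < z" "?B j = (1 - y) *\<^sub>R A j + y *\<^sub>R A (j + 2)"
        "?B (j + 1) = (1 - z) *\<^sub>R A j + z *\<^sub>R A (j + 2)"
      using pentagram_order_on_diagonal[OF n A] by metis
    \<comment> \<open>Eliminates \<open>A (j + 2)\<close> from the positions of \<open>?B j\<close>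
      and \<open>?B (j + 1)\<close> on their common diagonal.\<close>
    have c: "(z - y) *\<^sub>R homog (A j) = z *\<^sub>R homog (?B j) + (- y) *\<^sub>R homog (?B (j + 1))"
      unfolding yz homog_combination by (simp add: vec_eq_iff algebra_simps)
    have ne: "turn (A i) (?B m) (A m) \<noteq> 0" if "i = m - 2" for i m
      using pentagram_beyond_diagonal[OF n A that refl] turn_swap[of "A i" "?B m" "A m"] by auto
    have "P ?B j + (det3 (homog (A (j - 1))) v (homog (A (j + 1))) /
        det3 (homog (A (j - 1))) (homog (?B (j + 1))) (homog (A (j + 1)))) *\<^sub>R homog (?B (j + 1)) = P A j + K j"
      unfolding P_def K_def
    proof (rule pentagram_projections)
      show "homog (?B (j - 1)) = (1 - s) *\<^sub>R homog (A (j - 2)) + s *\<^sub>R homog (A j)"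
        unfolding st(3) homog_combination ..
      show "homog (?B (j - 1)) = (1 - t) *\<^sub>R homog (A (j - 1)) + t *\<^sub>R homog (A (j + 1))"
        unfolding st(4) homog_combination ..
      show "homog (?B j) = (1 - x) *\<^sub>R homog (A (j - 1)) + x *\<^sub>R homog (A (j + 1))"
        unfolding x homog_combination ..
      show "(z - y) *\<^sub>R homog (A j) = z *\<^sub>R homog (?B j) + (- y) *\<^sub>R homog (?B (j + 1))"
        by (rule c)
      show "det3 (homog (A (j - 2))) (homog (?B j)) (homog (A j)) \<noteq> 0"
        "det3 (homog (A (j - 1))) (homog (?B (j + 1))) (homog (A (j + 1))) \<noteq> 0"
        using ne[of "j - 2" j] ne[of "j - 1" "j + 1"] by (simp_all add: turn_def)
    qed (use st(1,2) yz(1,2) in auto)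
    then show ?thesis
      by (simp add: K_def)
  qed
  \<comment> \<open>Periodicity makes the telescoping sum over one period vanish.\<close>
  have "K (j + int n) = K j" for j
    using oriented_convex_periodic[OF A, of "j - 2"] oriented_convex_periodic[OF A, of j]
      oriented_convex_periodic[OF oriented_convex_pentagram[OF n A], of j]
    by (simp add: K_def algebra_simps)
  from this[of 1] have "K (int n + 1) = K 1"
    by (simp add: add.commute)
  moreover have "(\<Sum>j\<in>{1..int m}. K (j + 1) - K j) = K (int m + 1) - K 1" for m
  proof (induction m)
    case (Suc m)
    have "{1..int (Suc m)} = insert (int m + 1) {1..int m}"
      by auto
    then show ?case
      using Suc by (simp add: algebra_simps)
  qed simp
  moreover have "P A j - P ?B j = K (j + 1) - K j" for j
  proof -
    have "c - a = b - d" if "a + b = c + d" for a b c d :: "real^3"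
      using that by (simp add: algebra_simps)
    from this[OF step] show ?thesis .
  qed
  ultimately have "(\<Sum>j\<in>{1..int n}. P A j - P ?B j) = 0"
    by simp
  then show "L_map n ?B v = L_map n A v"
    by (simp add: L_map_def P_def sum_subtractf)
qed


section \<open>Iterates, and the cone over the lifted vertices\<close>

lemma oriented_convex_pentagram_power:
  assumes "5 \<le> n" "oriented_convex n \<sigma> A"
  shows "oriented_convex n \<sigma> ((pentagram ^^ k) A)"
  using assms by (induction k) (auto intro: oriented_convex_pentagram)

lemma L_map_pentagram_power:
  assumes "5 \<le> n" "oriented_convex n \<sigma> A"
  shows "L_map n ((pentagram ^^ k) A) = L_map n A"
  by (induction k) (simp_all add: L_map_pentagram[OF assms(1) oriented_convex_pentagram_power[OF assms]])

lemma L_map_vertex_in_cone: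
  assumes n: "5 \<le> n" and A: "oriented_convex n \<sigma> A"
  obtains c where "\<And>j. j \<in> {1..int n} \<Longrightarrow> 0 \<le> c j"
    "L_map n A (homog (A 1)) = (\<Sum>j\<in>{1..int n}. c j *\<^sub>R homog (A j))"
proof
  define c where "c j = (if j = 1 then real n else 0) -
      turn (A (j - 1)) (A 1) (A (j + 1)) / turn (A (j - 1)) (A j) (A (j + 1))" for j
  have "(\<Sum>j\<in>{1..int n}. (if j = 1 then real n else 0) *\<^sub>R homog (A j))
      = (\<Sum>j\<in>{1..int n}. if j = 1 then real n *\<^sub>R homog (A j) else 0)"
    by (rule sum.cong) auto
  also have "\<dots> = real n *\<^sub>R homog (A 1)"
    using n by simp
  finally show "L_map n A (homog (A 1)) = (\<Sum>j\<in>{1..int n}. c j *\<^sub>R homog (A j))"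
    by (simp add: L_map_def c_def turn_def scaleR_diff_left sum_subtractf)
  fix j assume j: "j \<in> {1..int n}"
  have shift: "A (1 + int n) = A 1"
    by (rule oriented_convex_periodic[OF A])
  consider "j = 1" | "j = 2" | "j = int n" | "2 < j" "j < int n"
    using j by fastforce
  then show "0 \<le> c j"
  proof cases
    case 1
    then show ?thesis
      using n by (simp add: c_def divide_self_if)
  next
    case 2
    then show ?thesis
      by (simp add: c_def)
  next
    case 3
    then show ?thesis
      using shift by (simp add: c_def add.commute)
  next
    case 4
    \<comment> \<open>Reading \<open>A 1\<close> as \<open>A (1 + int n)\<close> puts its index
      after \<open>j + 1\<close>, as the statement on diagonals requires.\<close>
    have num: "0 < \<sigma> * turn (A (j - 1)) (A (j + 1)) (A (1 + int n))"
      using oriented_convex_diagonal[OF A, of "j + 1" "j - 1" "1 + int n"] 4 by simp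
    have den: "0 < \<sigma> * turn (A (j - 1)) (A j) (A (j + 1))"
      using oriented_convex_edge[OF A, of j "j - 1" "j + 1"] n by simp
    have "0 \<le> (\<sigma> * turn (A (j - 1)) (A (j + 1)) (A 1)) / (\<sigma> * turn (A (j - 1)) (A j) (A (j + 1)))"
      using num den unfolding shift by (intro divide_nonneg_pos less_imp_le)
    moreover have "\<sigma> \<noteq> 0"
      using den by auto
    ultimately show ?thesis
      using 4 turn_swap[of "A (j - 1)" "A 1" "A (j + 1)"]
      by (simp add: c_def)
  qed
qed

section \<open>From faces of the convex hull to orientation signs\<close>

text \<open>For \<open>p \<noteq> q\<close>, both \<open>a \<bullet> x - b\<close> and
  \<open>turn p q x\<close> are affine in \<open>x\<close> and vanish on the line through
  \<open>p\<close> and \<open>q\<close>, hence are proportional.\<close>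

lemma turn_supporting_line:
  fixes p q x a :: "real^2"
  assumes "a \<bullet> p = b" "a \<bullet> q = b"
  shows "(a$2 * (q$1 - p$1) - a$1 * (q$2 - p$2)) * turn p q x = (a \<bullet> x - b) * ((q$1 - p$1)\<^sup>2 + (q$2 - p$2)\<^sup>2)"
proof -
  have "a$1 * p$1 + a$2 * p$2 = b" "a$1 * q$1 + a$2 * q$2 = b"
    using assms by (simp_all add: inner_vec_def sum_2)
  then have orth: "a$1 * (q$1 - p$1) + a$2 * (q$2 - p$2) = 0"
    and ax: "a \<bullet> x - b = a$1 * (x$1 - p$1) + a$2 * (x$2 - p$2)"
    by (simp_all add: inner_vec_def sum_2 algebra_simps)
  have "(a \<bullet> x - b) * ((q$1 - p$1)\<^sup>2 + (q$2 - p$2)\<^sup>2)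
      - (a$2 * (q$1 - p$1) - a$1 * (q$2 - p$2)) * turn p q x
      = (a$1 * (q$1 - p$1) + a$2 * (q$2 - p$2)) * ((q$1 - p$1) * (x$1 - p$1) + (q$2 - p$2) * (x$2 - p$2))"
    unfolding ax turn_expand by algebra
  then show ?thesis
    unfolding orth by simp
qed

text \<open>Faces of a polytope are exposed, so some supporting line meets the hull exactly in the
  edge. Points of \<open>S\<close> off the edge line are strictly on its inner side, and
  \<open>turn_supporting_line\<close> converts this into a sign with one factor for all
  \<open>x\<close>.\<close>

lemma edge_one_side:
  fixes p q :: "real^2"
  assumes S: "finite S" and pq: "p \<noteq> q" and edge: "closed_segment p q edge_of convex hull S"
  obtains c where "\<And>x. x \<in> S \<Longrightarrow> \<not> collinear {p, q, x} \<Longrightarrow> 0 < c * turn p q x"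
proof -
  have "polyhedron (convex hull S)"
    using S by (intro polytope_imp_polyhedron polytope_convex_hull)
  then have "closed_segment p q exposed_face_of convex hull S"
    using edge by (simp add: exposed_face_of_polyhedron edge_of_def)
  then obtain a b where ab: "convex hull S \<subseteq> {x. a \<bullet> x \<le> b}"
      "closed_segment p q = convex hull S \<inter> {x. a \<bullet> x = b}"
    by (auto simp: exposed_face_of_def)
  have "p \<in> closed_segment p q" "q \<in> closed_segment p q"
    by simp_all
  then have on: "a \<bullet> p = b" "a \<bullet> q = b"
    unfolding ab(2) by auto
  have pos: "0 < (q$1 - p$1)\<^sup>2 + (q$2 - p$2)\<^sup>2"
    using pq by (auto simp: vec_eq_iff forall_2 sum_power2_gt_zero_iff)
  show thesis
  proof (rule that)
    fix x assume x: "x \<in> S" "\<not> collinear {p, q, x}"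
    have "x \<notin> closed_segment p q"
      using x(2) between_imp_collinear[of p q x] by (auto simp: between_mem_segment insert_commute)
    moreover have "x \<in> convex hull S"
      using x(1) by (rule hull_inc)
    ultimately have "a \<bullet> x < b"
      using ab by fastforce
    then have "(a \<bullet> x - b) * ((q$1 - p$1)\<^sup>2 + (q$2 - p$2)\<^sup>2) < 0"
      using pos by (simp add: mult_neg_pos)
    then show "0 < (- (a$2 * (q$1 - p$1) - a$1 * (q$2 - p$2))) * turn p q x"
      unfolding turn_supporting_line[OF on, symmetric] by linarith
  qed
qed

lemma periodic_mult:
  fixes f :: "int \<Rightarrow> 'a"
  assumes "\<And>i. f (i + d) = f i"
  shows "f (i + d * m) = f i"
proof (induction m rule: int_induct[of _ 0])
  case base
  then show ?case by simp
next
  case (step1 m)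
  then show ?case using assms[of "i + d * m"] by (simp add: algebra_simps)
next
  case (step2 m)
  then show ?case using assms[of "i + d * (m - 1)"] by (simp add: algebra_simps)
qed

text \<open>Each edge has all other vertices on one side, recorded by the sign of
  \<open>\<tau> i\<close>. Consecutive edges share a corner triangle, so these signs agree, and
  their common value serves as \<open>\<sigma>\<close>.\<close>

lemma convex_ngon_oriented:
  assumes "convex_ngon n A"
  obtains \<sigma> where "oriented_convex n \<sigma> A"
proof -
  have n: "3 \<le> n" and per: "\<And>i. A (i + int n) = A i"
    and edge: "\<And>i. closed_segment (A i) (A (i + 1)) edge_of convex hull (range A)"
    and noncol: "\<And>i j k. i \<in> {1..int n} \<Longrightarrow> j \<in> {1..int n} \<Longrightarrow> k \<in> {1..int n} \<Longrightarrow>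
        i \<noteq> j \<Longrightarrow> i \<noteq> k \<Longrightarrow> j \<noteq> k \<Longrightarrow> \<not> collinear {A i, A j, A k}"
    using assms by (auto simp: convex_ngon_def)
  \<comment> \<open>Noncollinearity is given for indices in \<open>{1..int n}\<close>;
    \<open>f\<close> picks the representative there.\<close>
  define f where "f i = (i - 1) mod int n + 1" for i
  have f: "f i \<in> {1..int n}" for i
  proof -
    have "(i - 1) mod int n < int n" "0 \<le> (i - 1) mod int n"
      using n by simp_all
    then show ?thesis
      by (simp add: f_def)
  qed
  have Af: "A (f i) = A i" for i
  proof -
    have "A (f i + int n * ((i - 1) div int n)) = A (f i)"
      by (rule periodic_mult) (rule per)
    then show ?thesis
      by (simp add: f_def algebra_simps)
  qed
  have f_neq: "f i \<noteq> f j" if "i < j" "j < i + int n" for i j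
  proof
    assume "f i = f j"
    then have "(j - 1) mod int n = (i - 1) mod int n"
      by (simp add: f_def)
    then have "int n dvd (j - 1) - (i - 1)"
      unfolding mod_eq_dvd_iff .
    then show False
      using zdvd_imp_le[of "int n" "j - i"] that by simp
  qed
  have noncol': "\<not> collinear {A i, A j, A k}" if "i < j" "j < k" "k < i + int n" for i j k
    using noncol[of "f i" "f j" "f k"] f f_neq[of i j] f_neq[of i k] f_neq[of j k] that
    by (simp add: Af)
  have "range A = A ` {1..int n}"
    using f Af by (metis (no_types, lifting) image_eqI image_subset_iff rangeI subset_antisym subsetI)
  then have fin: "finite (range A)"
    by simp
  define \<tau> where "\<tau> i = turn (A i) (A (i + 1)) (A (i + 2))" for i
  have same_sign: "0 < \<tau> i * turn (A i) (A (i + 1)) (A k)" if k: "i + 1 < k" "k < i + int n" for i k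
  proof -
    have "A i \<noteq> A (i + 1)"
      using noncol'[of i "i + 1" "i + 2"] n by auto
    then obtain c where c: "\<And>x. x \<in> range A \<Longrightarrow> \<not> collinear {A i, A (i + 1), x} \<Longrightarrow> 0 < c * turn (A i) (A (i + 1)) x"
      using edge_one_side[OF fin _ edge] by metis
    have "0 < c * \<tau> i" "0 < c * turn (A i) (A (i + 1)) (A k)"
      using k n c[of "A (i + 2)"] c[of "A k"] noncol'[of i "i + 1" "i + 2"] noncol'[of i "i + 1" k]
      by (simp_all add: \<tau>_def)
    then show ?thesis
      by (auto simp: zero_less_mult_iff)
  qed
  have sgn_step: "sgn (\<tau> (i + 1)) = sgn (\<tau> i)" for i
  proof -
    have "i + 1 + 1 = i + 2"
      by simp
    \<comment> \<open>Taken as \<open>A (i + int n)\<close>, the vertex \<open>A i\<close> forms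
      with the next edge the triangle of \<open>\<tau> i\<close>, up to cyclic order.\<close>
    then have "0 < \<tau> (i + 1) * \<tau> i"
      using same_sign[of "i + 1" "i + int n"] n by (simp add: \<tau>_def per turn_cycle add.commute)
    then show ?thesis
      by (auto simp: zero_less_mult_iff)
  qed
  \<comment> \<open>A function on the integers with period 1 is constant.\<close>
  have sgn: "sgn (\<tau> i) = sgn (\<tau> 0)" for i
    using periodic_mult[of "\<lambda>i. sgn (\<tau> i)" 1 0 i, OF sgn_step] by simp
  have "oriented_convex n (sgn (\<tau> 0)) A"
    unfolding oriented_convex_def
  proof (intro conjI allI impI per)
    fix i k assume "i + 1 < k" "k < i + int n"
    then have "0 < \<tau> i * turn (A i) (A (i + 1)) (A k)"
      by (rule same_sign)
    then show "0 < sgn (\<tau> 0) * turn (A i) (A (i + 1)) (A k)"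
      unfolding sgn[of i, symmetric] by (auto simp: zero_less_mult_iff)
  qed
  then show thesis
    by (rule that)
qed

section \<open>Passage to the limit point\<close>

lemma tendsto_homog:
  assumes "(f \<longlongrightarrow> p) F"
  shows "((\<lambda>k. homog (f k)) \<longlongrightarrow> homog p) F"
proof (rule vec_tendstoI)
  fix i :: 3
  show "((\<lambda>k. homog (f k) $ i) \<longlongrightarrow> homog p $ i) F"
    using exhaust_3[of i] tendsto_vec_nth[OF assms] by auto
qed

theorem proposition1p2:
  fixes n :: nat and A :: "int \<Rightarrow> real^2" and X Y :: real
  assumes "n \<ge> 5"
    and "convex_ngon n A"
    and "\<forall>i. (\<lambda>k. (pentagram ^^ k) A i) \<longlonglongrightarrow> vector [X, Y]"
  shows "vector [X, Y, 1] eigenvector_of L_map n A"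
proof -
  define v :: "real^3" where "v = vector [X, Y, 1]"
  have v: "v = homog (vector [X, Y])"
    by (simp add: v_def homog_def)
  obtain \<sigma> where A: "oriented_convex n \<sigma> A"
    using convex_ngon_oriented[OF assms(2)] .
  define u where "u k j = homog ((pentagram ^^ k) A j)" for k j
  have u: "(\<lambda>k. u k j) \<longlonglongrightarrow> v" for j
    unfolding u_def v by (intro tendsto_homog) (use assms(3) in blast)
  have "bounded_linear (L_map n A)"
    using linear_L_map by (simp add: linear_conv_bounded_linear)
  then have L: "(\<lambda>k. L_map n A (u k 1)) \<longlonglongrightarrow> L_map n A v"
    using u by (rule bounded_linear.tendsto)
  \<comment> \<open>The cone coefficients vary with \<open>k\<close>, but lifts have third
    coordinate 1, so their sum is the third coordinate of the image. That coordinate converges and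
    controls all of them.\<close>
  have bound: "norm (L_map n A (u k 1) - (L_map n A (u k 1) $ 3) *\<^sub>R v)
      \<le> (L_map n A (u k 1) $ 3) * (\<Sum>j\<in>{1..int n}. norm (u k j - v))" for k
  proof -
    obtain c where c: "\<And>j. j \<in> {1..int n} \<Longrightarrow> 0 \<le> c j"
      "L_map n A (u k 1) = (\<Sum>j\<in>{1..int n}. c j *\<^sub>R u k j)"
      using L_map_vertex_in_cone[OF assms(1) oriented_convex_pentagram_power[OF assms(1) A], of k]
      unfolding L_map_pentagram_power[OF assms(1) A] u_def by metis
    have third: "L_map n A (u k 1) $ 3 = (\<Sum>j\<in>{1..int n}. c j)"
      unfolding c(2) by (simp add: u_def)
    have "norm (L_map n A (u k 1) - (L_map n A (u k 1) $ 3) *\<^sub>R v) = norm (\<Sum>j\<in>{1..int n}. c j *\<^sub>R (u k j - v))"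
      unfolding third unfolding c(2) by (simp add: scaleR_diff_right sum_subtractf scaleR_sum_left)
    also have "\<dots> \<le> (\<Sum>j\<in>{1..int n}. norm (c j *\<^sub>R (u k j - v)))"
      by (rule norm_sum)
    also have "\<dots> \<le> (\<Sum>j\<in>{1..int n}. (\<Sum>j\<in>{1..int n}. c j) * norm (u k j - v))"
    proof (rule sum_mono)
      fix j assume j: "j \<in> {1..int n}"
      then have "c j \<le> (\<Sum>j\<in>{1..int n}. c j)"
        using c(1) by (intro member_le_sum) auto
      then show "norm (c j *\<^sub>R (u k j - v)) \<le> (\<Sum>j\<in>{1..int n}. c j) * norm (u k j - v)"
        using c(1)[OF j] by (simp add: mult_right_mono)
    qed
    finally show ?thesis
      by (simp add: third sum_distrib_left)
  qed
  have L3: "(\<lambda>k. L_map n A (u k 1) $ 3) \<longlonglongrightarrow> L_map n A v $ 3"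
    by (rule tendsto_vec_nth[OF L])
  have "(\<lambda>k. norm (L_map n A (u k 1) - (L_map n A (u k 1) $ 3) *\<^sub>R v))
      \<longlonglongrightarrow> norm (L_map n A v - (L_map n A v $ 3) *\<^sub>R v)"
    by (intro tendsto_intros L L3)
  moreover have "(\<lambda>k. (L_map n A (u k 1) $ 3) * (\<Sum>j\<in>{1..int n}. norm (u k j - v)))
      \<longlonglongrightarrow> (L_map n A v $ 3) * (\<Sum>j\<in>{1..int n}. norm (v - v))"
    by (intro tendsto_intros L3 u)
  \<comment> \<open>The right-hand limit is zero, so the eigenvalue is the third coordinate of the
    image of \<open>v\<close>.\<close>
  ultimately have "norm (L_map n A v - (L_map n A v $ 3) *\<^sub>R v) \<le> (L_map n A v $ 3) * (\<Sum>j\<in>{1..int n}. norm (v - v))"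
    by (rule LIMSEQ_le) (use bound in blast)
  then have "L_map n A v = (L_map n A v $ 3) *\<^sub>R v"
    by simp
  moreover have "v $ 3 = 1"
    by (simp add: v)
  then have "v \<noteq> 0"
    by auto
  ultimately show ?thesis
    unfolding eigenvector_of_def v_def[symmetric] by blast
qed

end
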